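(* Let $G$ be a countable infinite residually finite group, and let $X$ be a free exact odometer of $G$. Then $\mathrm{Aut}^{\infty}(X,\alpha_X,G)=[[R_X]]$ as subgroups of $\mathrm{Homeo}(X)$.
   Context: Let $G$ be a countable group. A scale of $G$ is a decreasing sequence $(\Gamma_n)_{n\in\mathbb{N}}$ of normal finite-index subgroups of $G$ with $\bigcap_n\Gamma_n=\{1_G\}$. The free exact odometer associated with the scale is $X=G_{(\Gamma_n)}=\{(x_n)_n\in\prod_n G/\Gamma_n : x_{n+1}\mapsto x_n \text{ under } G/\Gamma_{n+1}\to G/\Gamma_n \text{ for all } n\}$, a subgroup of the product group with the topology induced by the product of the discrete topologies. A free exact odometer of $G$ is one associated with some scale of $G$. The injective homomorphism $\tau:G\to X$, $\tau(g)=(g\Gamma_n)_n$, has dense image, and $\alpha_X$ is the action of $G$ on $X$ given by $\alpha_X^g(x)=\tau(g)x$. $R_X$ is the left action of the group $X$ on the space $X$ given by $R_X^{\xi}(x)=x\xi^{-1}$. For an action $\alpha$ of a (not necessarily countable) group $K$ by homeomorphisms on a compact totally disconnected metrizable space $Z$, the topological full group $[[\alpha]]$ is the group of all homeomorphisms $f$ of $Z$ for which there exist a finite clopen partition $\{A_1,\dots,A_k\}$ of $Z$ and $g_1,\dots,g_k\in K$ with $f(y)=\alpha^{g_i}(y)$ for all $y\in A_i$, $1\le i\le k$. For an action $\alpha$ of a group $G$ on $X$ by homeomorphisms, $\mathrm{Aut}(X,\alpha,G)$ is the group of homeomorphisms $f$ of $X$ with $f\circ\alpha^g=\alpha^g\circ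 f$ for all $g\in G$. The stabilized automorphism group is $\mathrm{Aut}^\infty(X,\alpha,G)=\bigcup_{H}\mathrm{Aut}(X,\alpha|_H,H)$, the union over all finite-index subgroups $H$ of $G$, where $\alpha|_H$ is the restriction of the action to $H$. *)

theory Defs
  imports "HOL-Analysis.Analysis" "HOL-Algebra.Product_Groups" "HOL-Algebra.Group_Action"
begin

section \<open>Finite-index subgroups and scales\<close>

definition finite_index_subgroup :: "'a set \<Rightarrow> ('a, 'b) monoid_scheme \<Rightarrow> bool"
  where "finite_index_subgroup H G \<longleftrightarrow> subgroup H G \<and> finite (rcosets\<^bsub>G\<^esub> H)"

definition residually_finite :: "('a, 'b) monoid_scheme \<Rightarrow> bool"
  where "residually_finite G \<longleftrightarrow>
    (\<forall>g \<in> carrier G. g \<noteq> \<one>\<^bsub>G\<^esub> \<longrightarrow> (\<exists>N. N \<lhd> G \<and> finite_index_subgroup N G \<and> g \<notin> N))"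

text \<open>``Decreasing'' is read non-strictly.\<close>

definition group_scale :: "('a, 'b) monoid_scheme \<Rightarrow> (nat \<Rightarrow> 'a set) \<Rightarrow> bool"
  where "group_scale G \<Gamma> \<longleftrightarrow>
    (\<forall>n. \<Gamma> n \<lhd> G \<and> finite_index_subgroup (\<Gamma> n) G) \<and> decseq \<Gamma> \<and> (\<Inter>n. \<Gamma> n) = {\<one>\<^bsub>G\<^esub>}"

section \<open>The odometer of a scale\<close>

text \<open>The library realises \<open>G Mod N\<close> on the right cosets \<open>N #> g\<close>; as the \<open>\<Gamma> n\<close> are normal these
  are the cosets \<open>g <# N\<close>. The existential below is the graph of the canonical projection
  \<open>G Mod \<Gamma> (Suc n) \<rightarrow> G Mod \<Gamma> n\<close>.\<close>

definition odometer :: "('a, 'b) monoid_scheme \<Rightarrow> (nat \<Rightarrow> 'a set) \<Rightarrow> (nat \<Rightarrow> 'a set) monoid"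
  where "odometer G \<Gamma> = (product_group UNIV (\<lambda>n. G Mod \<Gamma> n))
    \<lparr>carrier := {x \<in> carrier (product_group UNIV (\<lambda>n. G Mod \<Gamma> n)).
       \<forall>n. \<exists>g \<in> carrier G. x (Suc n) = \<Gamma> (Suc n) #>\<^bsub>G\<^esub> g \<and> x n = \<Gamma> n #>\<^bsub>G\<^esub> g}\<rparr>"

definition odometer_topology :: "('a, 'b) monoid_scheme \<Rightarrow> (nat \<Rightarrow> 'a set) \<Rightarrow> (nat \<Rightarrow> 'a set) topology"
  where "odometer_topology G \<Gamma> =
    subtopology (product_topology (\<lambda>n. discrete_topology (carrier (G Mod \<Gamma> n))) UNIV)
      (carrier (odometer G \<Gamma>))"

definition odometer_embedding :: "('a, 'b) monoid_scheme \<Rightarrow> (nat \<Rightarrow> 'a set) \<Rightarrow> 'a \<Rightarrow> nat \<Rightarrow> 'a set"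
  where "odometer_embedding G \<Gamma> g = (\<lambda>n. \<Gamma> n #>\<^bsub>G\<^esub> g)"

text \<open>As in \<open>group_action\<close>, an action of a group \<open>K\<close> is a map from \<open>carrier K\<close> to maps of the space
  that are \<open>undefined\<close> off the space.\<close>

definition odometer_action :: "('a, 'b) monoid_scheme \<Rightarrow> (nat \<Rightarrow> 'a set) \<Rightarrow> 'a \<Rightarrow>
    (nat \<Rightarrow> 'a set) \<Rightarrow> (nat \<Rightarrow> 'a set)"
  where "odometer_action G \<Gamma> g =
    (\<lambda>x \<in> carrier (odometer G \<Gamma>). odometer_embedding G \<Gamma> g \<otimes>\<^bsub>odometer G \<Gamma>\<^esub> x)"

definition right_mult_action :: "('x, 'b) monoid_scheme \<Rightarrow> 'x \<Rightarrow> 'x \<Rightarrow> 'x"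
  where "right_mult_action X \<xi> = (\<lambda>x \<in> carrier X. x \<otimes>\<^bsub>X\<^esub> inv\<^bsub>X\<^esub> \<xi>)"

section \<open>Groups of homeomorphisms\<close>

text \<open>Homeomorphisms are taken extensional, as in \<open>Bij\<close>, so that equality of elements is equality
  of maps on the space.\<close>

definition Homeo :: "'z topology \<Rightarrow> ('z \<Rightarrow> 'z) set"
  where "Homeo T = {f \<in> extensional (topspace T). homeomorphic_map T T f}"

definition HomeoGroup :: "'z topology \<Rightarrow> ('z \<Rightarrow> 'z) monoid"
  where "HomeoGroup T = BijGroup (topspace T) \<lparr>carrier := Homeo T\<rparr>"

definition topological_full_group ::
    "('k, 'b) monoid_scheme \<Rightarrow> 'z topology \<Rightarrow> ('k \<Rightarrow> 'z \<Rightarrow> 'z) \<Rightarrow> ('z \<Rightarrow> 'z) set"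
  where "topological_full_group K T \<alpha> = {f \<in> Homeo T.
    \<exists>P g. finite P \<and> partition_on (topspace T) P \<and>
      (\<forall>A \<in> P. openin T A \<and> closedin T A \<and> g A \<in> carrier K \<and> (\<forall>y \<in> A. f y = \<alpha> (g A) y))}"

definition action_Aut ::
    "'z topology \<Rightarrow> ('k \<Rightarrow> 'z \<Rightarrow> 'z) \<Rightarrow> ('k, 'b) monoid_scheme \<Rightarrow> ('z \<Rightarrow> 'z) set"
  where "action_Aut T \<alpha> K =
    {f \<in> Homeo T. \<forall>g \<in> carrier K. \<forall>x \<in> topspace T. f (\<alpha> g x) = \<alpha> g (f x)}"

definition stabilized_Aut ::
    "'z topology \<Rightarrow> ('k \<Rightarrow> 'z \<Rightarrow> 'z) \<Rightarrow> ('k, 'b) monoid_scheme \<Rightarrow> ('z \<Rightarrow> 'z) set"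
  where "stabilized_Aut T \<alpha> G =
    (\<Union>H \<in> {H. finite_index_subgroup H G}. action_Aut T \<alpha> (G\<lparr>carrier := H\<rparr>))"

end

theory Submission
  imports Defs
begin

text \<open>
  For \<open>f\<close> commuting with a finite-index subgroup \<open>H\<close>, consider \<open>c(x) = x\<^sup>-\<^sup>1 f(x)\<close>. It is continuous and
  invariant under \<open>\<tau>(H)\<close>, so it takes finitely many values on the dense subgroup \<open>\<tau>(G)\<close> and hence
  on \<open>X\<close>; its fibres are a clopen partition on each piece of which \<open>f\<close> is right multiplication by
  a constant. Conversely, by compactness the clopen pieces of an element of \<open>[[R\<^sub>X]]\<close> are unions of
  cylinders of one level \<open>n\<close>; these are preserved by \<open>\<tau>(\<Gamma>\<^sub>n)\<close>, and left and right multiplications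
  commute. So the stabilized automorphism group is already the increasing union of the
  automorphism groups of the \<open>\<Gamma>\<^sub>n\<close>, which makes it a subgroup.
\<close>

section \<open>Homeomorphism groups, commutants and increasing unions of subgroups\<close>

lemma Homeo_Bij:
  assumes "f \<in> Homeo S"
  shows "f \<in> Bij (topspace S)"
proof -
  have "homeomorphic_map S S f" and "f \<in> extensional (topspace S)"
    using assms by (simp_all add: Homeo_def)
  then show ?thesis
    by (simp add: Bij_def bij_betw_def homeomorphic_imp_injective_map homeomorphic_imp_surjective_map)
qed

lemma subgroup_Homeo: "subgroup (Homeo S) (BijGroup (topspace S))"
proof (rule group.subgroupI[OF group_BijGroup])
  show "Homeo S \<subseteq> carrier (BijGroup (topspace S))"
    using Homeo_Bij by (auto simp: BijGroup_def)
  have "homeomorphic_map S S (\<lambda>x\<in>topspace S. x)"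
    by (rule homeomorphic_map_eq[of _ _ id]) auto
  then show "Homeo S \<noteq> {}"
    by (auto simp: Homeo_def)
  fix f assume f: "f \<in> Homeo S"
  then have fB: "f \<in> Bij (topspace S)" by (rule Homeo_Bij)
  obtain g where g: "homeomorphic_maps S S f g"
    using f by (auto simp: Homeo_def homeomorphic_map_maps)
  \<comment> \<open>The group inverse in \<open>BijGroup\<close> is built from
    \<open>inv_into\<close>, which carries no topology. Its agreement on the space with the
    topological inverse \<open>g\<close> makes it a homeomorphism.\<close>
  have "g x = inv_into (topspace S) f x" if "x \<in> topspace S" for x
  proof -
    have "g x \<in> topspace S" "f (g x) = x"
      using g that by (auto simp: homeomorphic_maps_def continuous_map_def)
    then show ?thesis
      using fB by (metis Bij_def IntD2 bij_betw_imp_inj_on inv_into_f_f mem_Collect_eq)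
  qed
  then have "homeomorphic_map S S (\<lambda>x\<in>topspace S. inv_into (topspace S) f x)"
    using g by (auto intro: homeomorphic_map_eq[of S S g] simp: homeomorphic_maps_map)
  then show "inv\<^bsub>BijGroup (topspace S)\<^esub> f \<in> Homeo S"
    by (simp add: inv_BijGroup[OF fB] Homeo_def)
next
  fix f g assume f: "f \<in> Homeo S" and g: "g \<in> Homeo S"
  then have "f \<in> Bij (topspace S)" "g \<in> Bij (topspace S)"
    by (simp_all add: Homeo_Bij)
  moreover have "homeomorphic_map S S (compose (topspace S) f g)"
  proof (rule homeomorphic_map_eq)
    show "homeomorphic_map S S (f \<circ> g)"
      using f g by (intro homeomorphic_map_compose[of S S g S f]) (simp_all add: Homeo_def)
  qed (simp add: compose_def)
  ultimately show "f \<otimes>\<^bsub>BijGroup (topspace S)\<^esub> g \<in> Homeo S"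
    by (simp add: BijGroup_def Homeo_def compose_def)
qed

lemma group_HomeoGroup: "group (HomeoGroup S)"
  unfolding HomeoGroup_def by (rule subgroup.subgroup_is_group[OF subgroup_Homeo group_BijGroup])

lemma inv_HomeoGroup:
  "f \<in> Homeo S \<Longrightarrow> inv\<^bsub>HomeoGroup S\<^esub> f = (\<lambda>x\<in>topspace S. inv_into (topspace S) f x)"
  unfolding HomeoGroup_def
  by (simp add: group.m_inv_consistent[OF group_BijGroup subgroup_Homeo] inv_BijGroup Homeo_Bij)

lemma mult_HomeoGroup:
  "\<lbrakk>f \<in> Homeo S; g \<in> Homeo S\<rbrakk> \<Longrightarrow> f \<otimes>\<^bsub>HomeoGroup S\<^esub> g = compose (topspace S) f g"
  by (simp add: HomeoGroup_def BijGroup_def Homeo_Bij)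

lemma carrier_HomeoGroup: "carrier (HomeoGroup S) = Homeo S"
  by (simp add: HomeoGroup_def)

text \<open>The maps \<open>\<alpha> g\<close> must preserve the space because elements of
  \<open>Homeo\<close> are controlled only there: the identity, inverses and composites can be
  evaluated at \<open>\<alpha> g x\<close> only if this point lies in the space.\<close>

lemma subgroup_action_Aut:
  assumes \<alpha>: "\<And>g x. \<lbrakk>g \<in> carrier K; x \<in> topspace S\<rbrakk> \<Longrightarrow> \<alpha> g x \<in> topspace S"
  shows "subgroup (action_Aut S \<alpha> K) (HomeoGroup S)"
proof (rule group.subgroupI[OF group_HomeoGroup])
  show "action_Aut S \<alpha> K \<subseteq> carrier (HomeoGroup S)"
    by (auto simp: action_Aut_def carrier_HomeoGroup)
  have "\<one>\<^bsub>HomeoGroup S\<^esub> \<in> Homeo S"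
    using monoid.one_closed[OF group.is_monoid[OF group_HomeoGroup[of S]]]
    by (simp add: carrier_HomeoGroup)
  then have "\<one>\<^bsub>HomeoGroup S\<^esub> \<in> action_Aut S \<alpha> K"
    using \<alpha> by (auto simp: action_Aut_def HomeoGroup_def BijGroup_def)
  then show "action_Aut S \<alpha> K \<noteq> {}" by blast
next
  fix f assume f: "f \<in> action_Aut S \<alpha> K"
  then have fH: "f \<in> Homeo S" by (simp add: action_Aut_def)
  let ?g = "inv_into (topspace S) f"
  have bij: "bij_betw f (topspace S) (topspace S)"
    using Homeo_Bij[OF fH] by (simp add: Bij_def)
  have g: "?g x \<in> topspace S" "f (?g x) = x" if "x \<in> topspace S" for x
    using that bij by (auto simp: bij_betw_def inv_into_into f_inv_into_f)
  have "?g (\<alpha> k x) = \<alpha> k (?g x)" if k: "k \<in> carrier K" and x: "x \<in> topspace S" for k x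
  proof -
    have "f (\<alpha> k (?g x)) = \<alpha> k x"
      using f k g[OF x] by (simp add: action_Aut_def)
    then show ?thesis
      using inv_into_f_f[OF bij_betw_imp_inj_on[OF bij] \<alpha>[OF k g(1)[OF x]]] by simp
  qed
  then have "\<forall>k\<in>carrier K. \<forall>x\<in>topspace S.
      (inv\<^bsub>HomeoGroup S\<^esub> f) (\<alpha> k x) = \<alpha> k ((inv\<^bsub>HomeoGroup S\<^esub> f) x)"
    using \<alpha> by (simp add: inv_HomeoGroup[OF fH])
  moreover have "inv\<^bsub>HomeoGroup S\<^esub> f \<in> Homeo S"
    using group.inv_closed[OF group_HomeoGroup, of f S] fH by (simp add: carrier_HomeoGroup)
  ultimately show "inv\<^bsub>HomeoGroup S\<^esub> f \<in> action_Aut S \<alpha> K"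
    by (simp add: action_Aut_def)
next
  fix f g assume f: "f \<in> action_Aut S \<alpha> K" and g: "g \<in> action_Aut S \<alpha> K"
  then have H: "f \<in> Homeo S" "g \<in> Homeo S" by (simp_all add: action_Aut_def)
  have "g x \<in> topspace S" if "x \<in> topspace S" for x
    using Bij_imp_funcset[OF Homeo_Bij[OF H(2)]] that by auto
  then have "\<forall>k\<in>carrier K. \<forall>x\<in>topspace S.
      (f \<otimes>\<^bsub>HomeoGroup S\<^esub> g) (\<alpha> k x) = \<alpha> k ((f \<otimes>\<^bsub>HomeoGroup S\<^esub> g) x)"
    using f g \<alpha> by (simp add: mult_HomeoGroup[OF H] compose_def action_Aut_def)
  moreover have "f \<otimes>\<^bsub>HomeoGroup S\<^esub> g \<in> Homeo S"
    using monoid.m_closed[OF group.is_monoid[OF group_HomeoGroup], of f S g] H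
    by (simp add: carrier_HomeoGroup)
  ultimately show "f \<otimes>\<^bsub>HomeoGroup S\<^esub> g \<in> action_Aut S \<alpha> K"
    by (simp add: action_Aut_def)
qed

text \<open>In a chain any two elements lie in a common member, which gives closure under
  products.\<close>

lemma subgroup_incseq_UN:
  assumes "group K" and sub: "\<And>n. subgroup (A n) K" and "incseq A"
  shows "subgroup (\<Union>n. A n) K"
proof (rule group.subgroupI[OF \<open>group K\<close>])
  show "(\<Union>n. A n) \<subseteq> carrier K"
    using subgroup.subset[OF sub] by blast
  show "(\<Union>n. A n) \<noteq> {}"
    using subgroup.one_closed[OF sub] by blast
  show "inv\<^bsub>K\<^esub> a \<in> (\<Union>n. A n)" if "a \<in> (\<Union>n. A n)" for a
    using that subgroup.m_inv_closed[OF sub] by blast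
  fix a b assume "a \<in> (\<Union>n. A n)" "b \<in> (\<Union>n. A n)"
  then obtain i j where "a \<in> A i" "b \<in> A j" by blast
  then have "a \<in> A (max i j)" "b \<in> A (max i j)"
    using monoD[OF \<open>incseq A\<close>] by (meson max.cobounded1 max.cobounded2 subsetD)+
  then show "a \<otimes>\<^bsub>K\<^esub> b \<in> (\<Union>n. A n)"
    using subgroup.m_closed[OF sub] by blast
qed

section \<open>The group structure of the odometer\<close>

locale scaled_group = group G for G :: "('a, 'b) monoid_scheme" (structure) +
  fixes \<Gamma> :: "nat \<Rightarrow> 'a set"
  assumes scale: "group_scale G \<Gamma>"
begin

abbreviation X where "X \<equiv> odometer G \<Gamma>"
abbreviation T where "T \<equiv> odometer_topology G \<Gamma>"
abbreviation \<tau> where "\<tau> \<equiv> odometer_embedding G \<Gamma>"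

lemma normal_scale: "\<Gamma> n \<lhd> G"
  and finite_index_scale: "finite_index_subgroup (\<Gamma> n) G"
  and scale_mono: "m \<le> n \<Longrightarrow> \<Gamma> n \<subseteq> \<Gamma> m"
  using scale unfolding group_scale_def by (auto simp: decseq_def)

lemma subgroup_scale: "subgroup (\<Gamma> n) G"
  using finite_index_scale by (simp add: finite_index_subgroup_def)

lemma group_Mod: "group (G Mod \<Gamma> n)"
  by (rule normal.factorgroup_is_group[OF normal_scale])

lemma carrier_X: "carrier X = {x. (\<forall>n. x n \<in> carrier (G Mod \<Gamma> n)) \<and>
    (\<forall>n. \<exists>g \<in> carrier G. x (Suc n) = \<Gamma> (Suc n) #> g \<and> x n = \<Gamma> n #> g)}"
  by (auto simp: odometer_def PiE_iff)

lemma consecutive_rep: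
  assumes "x \<in> carrier X"
  obtains g where "g \<in> carrier G" "x (Suc n) = \<Gamma> (Suc n) #> g" "x n = \<Gamma> n #> g"
  using assms unfolding carrier_X by blast

lemma mult_X: "(x \<otimes>\<^bsub>X\<^esub> y) n = x n \<otimes>\<^bsub>G Mod \<Gamma> n\<^esub> y n"
  by (simp add: odometer_def)

lemma embedding_in_X: "g \<in> carrier G \<Longrightarrow> \<tau> g \<in> carrier X"
  by (auto simp: carrier_X odometer_embedding_def carrier_FactGroup)

text \<open>Compatibility says that two consecutive coordinates have a common representative.
  Inverses and products of common representatives are again common, since the quotient maps are
  homomorphisms.\<close>

lemma subgroup_X: "subgroup (carrier X) (product_group UNIV (\<lambda>n. G Mod \<Gamma> n))"
proof (rule group.subgroupI)
  show "group (product_group UNIV (\<lambda>n. G Mod \<Gamma> n))"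
    by (simp add: group_Mod)
  show "carrier X \<subseteq> carrier (product_group UNIV (\<lambda>n. G Mod \<Gamma> n))"
    by (auto simp: odometer_def)
  show "carrier X \<noteq> {}"
    using embedding_in_X[OF one_closed] by auto
next
  fix x assume x: "x \<in> carrier X"
  have "\<exists>g\<in>carrier G. set_inv (x (Suc n)) = \<Gamma> (Suc n) #> g \<and> set_inv (x n) = \<Gamma> n #> g" for n
  proof -
    obtain g where "g \<in> carrier G" "x (Suc n) = \<Gamma> (Suc n) #> g" "x n = \<Gamma> n #> g"
      using x by (rule consecutive_rep)
    then show ?thesis
      by (intro bexI[of _ "inv g"]) (simp_all add: normal.rcos_inv[OF normal_scale])
  qed
  moreover have "set_inv (x n) \<in> carrier (G Mod \<Gamma> n)" for n
    using x normal.setinv_closed[OF normal_scale] by (auto simp: carrier_X FactGroup_def)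
  moreover have "(inv\<^bsub>product_group UNIV (\<lambda>n. G Mod \<Gamma> n)\<^esub> x) n = set_inv (x n)" for n
    using x by (subst inv_product_group)
      (auto simp: carrier_X group_Mod normal.inv_FactGroup[OF normal_scale])
  ultimately show "inv\<^bsub>product_group UNIV (\<lambda>n. G Mod \<Gamma> n)\<^esub> x \<in> carrier X"
    by (simp add: carrier_X)
next
  fix x y assume x: "x \<in> carrier X" and y: "y \<in> carrier X"
  have "\<exists>g\<in>carrier G. x (Suc n) <#> y (Suc n) = \<Gamma> (Suc n) #> g \<and> x n <#> y n = \<Gamma> n #> g" for n
  proof -
    obtain g where "g \<in> carrier G" "x (Suc n) = \<Gamma> (Suc n) #> g" "x n = \<Gamma> n #> g"
      using x by (rule consecutive_rep)
    moreover obtain h where "h \<in> carrier G" "y (Suc n) = \<Gamma> (Suc n) #> h" "y n = \<Gamma> n #> h"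
      using y by (rule consecutive_rep)
    ultimately show ?thesis
      by (intro bexI[of _ "g \<otimes> h"]) (simp_all add: normal.rcos_sum[OF normal_scale])
  qed
  moreover have "x n <#> y n \<in> carrier (G Mod \<Gamma> n)" for n
    using x y normal.setmult_closed[OF normal_scale] by (auto simp: carrier_X FactGroup_def)
  ultimately show "x \<otimes>\<^bsub>product_group UNIV (\<lambda>n. G Mod \<Gamma> n)\<^esub> y \<in> carrier X"
    by (simp add: carrier_X)
qed

sublocale X: group X
  using subgroup.subgroup_is_group[OF subgroup_X] group_Mod
  by (simp add: odometer_def)

lemma inv_X:
  assumes "x \<in> carrier X"
  shows "(inv\<^bsub>X\<^esub> x) n = inv\<^bsub>G Mod \<Gamma> n\<^esub> x n"
proof -
  have "inv\<^bsub>X\<^esub> x = inv\<^bsub>product_group UNIV (\<lambda>n. G Mod \<Gamma> n)\<^esub> x"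
    using group.m_inv_consistent[OF _ subgroup_X assms] group_Mod
    by (simp add: odometer_def)
  then show ?thesis
    using assms by (subst (asm) inv_product_group) (auto simp: carrier_X group_Mod)
qed

section \<open>Comparing levels, and the dense copy of \<open>G\<close>\<close>

lemma coordinate_rep:
  assumes "x \<in> carrier X"
  obtains g where "g \<in> carrier G" "x n = \<Gamma> n #> g"
  using consecutive_rep[OF assms] by metis

lemma coset_mono:
  assumes "m \<le> n" "g \<in> carrier G" "h \<in> carrier G" "\<Gamma> n #> g = \<Gamma> n #> h"
  shows "\<Gamma> m #> g = \<Gamma> m #> h"
proof -
  have "g \<in> \<Gamma> n #> h"
    using assms rcos_self[OF _ subgroup_scale] by metis
  then have "g \<in> \<Gamma> m #> h"
    using scale_mono[OF assms(1)] by (auto simp: r_coset_def)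
  then show ?thesis
    using assms(3) repr_independence subgroup_scale by metis
qed

text \<open>The carrier relates only neighbouring levels; downward induction from \<open>n\<close>
  extends this to all \<open>m \<le> n\<close>.\<close>

lemma coordinate_mono:
  assumes "x \<in> carrier X" "g \<in> carrier G" "x n = \<Gamma> n #> g" "m \<le> n"
  shows "x m = \<Gamma> m #> g"
  using \<open>m \<le> n\<close>
proof (induction rule: inc_induct)
  case (step k)
  \<comment> \<open>The representative \<open>h\<close> may differ from \<open>g\<close>, but both
    give the same coset at level \<open>Suc k\<close>, hence also at level \<open>k\<close>.\<close>
  obtain h where "h \<in> carrier G" "x (Suc k) = \<Gamma> (Suc k) #> h" "x k = \<Gamma> k #> h"
    using assms(1) by (rule consecutive_rep)
  then show ?case
    using step.IH assms(2) coset_mono[of k "Suc k" g h] by simp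
qed (rule assms)

lemma agree_mono:
  assumes "x \<in> carrier X" "y \<in> carrier X" "x n = y n" "m \<le> n"
  shows "x m = y m"
  using assms coordinate_mono by (metis coordinate_rep)

lemma embedding_mult:
  "\<lbrakk>g \<in> carrier G; h \<in> carrier G\<rbrakk> \<Longrightarrow> \<tau> (g \<otimes> h) = \<tau> g \<otimes>\<^bsub>X\<^esub> \<tau> h"
  by (rule ext) (simp add: mult_X odometer_embedding_def normal.rcos_sum[OF normal_scale])

text \<open>Density of the image of \<open>\<tau>\<close>, phrased through cylinders: each nonempty
  level-\<open>n\<close> cylinder contains some \<open>\<tau> g\<close>.\<close>

lemma embedding_dense:
  assumes "x \<in> carrier X"
  obtains g where "g \<in> carrier G" "\<tau> g n = x n"
  using coordinate_rep[OF assms, of n] by (metis odometer_embedding_def)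

text \<open>An element of \<open>\<Gamma> n\<close> becomes trivial in
  \<open>G Mod \<Gamma> n\<close>, so left translation by it maps each level-\<open>n\<close>
  cylinder into itself.\<close>

lemma embedding_mult_scale:
  assumes "h \<in> \<Gamma> n" "x \<in> carrier X"
  shows "(\<tau> h \<otimes>\<^bsub>X\<^esub> x) n = x n"
proof -
  have "\<tau> h n = \<one>\<^bsub>G Mod \<Gamma> n\<^esub>"
    using subgroup.rcos_const[OF subgroup_scale is_group assms(1)]
    by (simp add: odometer_embedding_def)
  then show ?thesis
    using assms(2) group.is_monoid[OF group_Mod]
    \<comment> \<open>The two \<open>FactGroup\<close> rules would unfold the quotient operations
      into set products and hide the unit law.\<close>
    by (simp only: mult_X) (simp add: carrier_X monoid.l_one del: mult_FactGroup one_FactGroup)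
qed

section \<open>Cylinders, compactness and separation of finite sets\<close>

lemma topspace_T: "topspace T = carrier X"
  by (auto simp: odometer_topology_def carrier_X)

text \<open>A cylinder is determined by a single coordinate, because in a compatible sequence each
  coordinate determines all earlier ones.\<close>

lemma openin_T:
  "openin T U \<longleftrightarrow> U \<subseteq> carrier X \<and> (\<forall>x\<in>U. \<exists>n. \<forall>y\<in>carrier X. y n = x n \<longrightarrow> y \<in> U)"
proof (intro iffI conjI ballI)
  assume U: "openin T U"
  then show "U \<subseteq> carrier X"
    using openin_subset topspace_T by blast
  fix x assume "x \<in> U"
  then have x: "x \<in> carrier X" using \<open>U \<subseteq> carrier X\<close> by auto
  obtain V where V: "openin (product_topology (\<lambda>n. discrete_topology (carrier (G Mod \<Gamma> n))) UNIV) V"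
    "U = V \<inter> carrier X"
    using U by (auto simp: odometer_topology_def openin_subtopology)
  then obtain W where W: "finite {i. W i \<noteq> carrier (G Mod \<Gamma> i)}" "x \<in> Pi\<^sub>E UNIV W" "Pi\<^sub>E UNIV W \<subseteq> V"
    using \<open>x \<in> U\<close> unfolding openin_product_topology_alt by fastforce
  \<comment> \<open>A basic box restricts only finitely many coordinates; \<open>n\<close> bounds
    their indices. Up to \<open>n\<close> the box is entered by agreement with \<open>x\<close>, and
    beyond \<open>n\<close> its factors are everything.\<close>
  obtain n where n: "\<And>i. W i \<noteq> carrier (G Mod \<Gamma> i) \<Longrightarrow> i \<le> n"
    using W(1) by (metis (mono_tags, lifting) finite_nat_set_iff_bounded_le mem_Collect_eq)
  have "y \<in> U" if y: "y \<in> carrier X" "y n = x n" for y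
  proof -
    have "y i \<in> W i" for i
    proof (cases "i \<le> n")
      case True
      then have "y i = x i" using agree_mono x y by blast
      then show ?thesis using W(2) by auto
    next
      case False
      then show ?thesis using n y(1) by (force simp: carrier_X)
    qed
    then show ?thesis using W(3) V(2) y(1) by auto
  qed
  then show "\<exists>n. \<forall>y\<in>carrier X. y n = x n \<longrightarrow> y \<in> U" by blast
next
  assume U: "U \<subseteq> carrier X \<and> (\<forall>x\<in>U. \<exists>n. \<forall>y\<in>carrier X. y n = x n \<longrightarrow> y \<in> U)"
  have cyl: "openin T {y \<in> carrier X. y n = c}" for n c
  proof -
    have "continuous_map T (discrete_topology (carrier (G Mod \<Gamma> n))) (\<lambda>y. y n)"
      unfolding odometer_topology_def
      by (intro continuous_map_from_subtopology continuous_map_product_projection) auto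
    \<comment> \<open>Since \<open>c\<close> is arbitrary and need not be a coset, it is cut down to
      the discrete space before its preimage is taken.\<close>
    then have "openin T {y \<in> topspace T. y n \<in> {c} \<inter> carrier (G Mod \<Gamma> n)}"
      by (rule openin_continuous_map_preimage) simp
    moreover have "{y \<in> topspace T. y n \<in> {c} \<inter> carrier (G Mod \<Gamma> n)} = {y \<in> carrier X. y n = c}"
      by (auto simp: topspace_T carrier_X)
    ultimately show ?thesis by simp
  qed
  show "openin T U"
  proof (subst openin_subopen, rule ballI)
    fix x assume "x \<in> U"
    then obtain n where "\<forall>y\<in>carrier X. y n = x n \<longrightarrow> y \<in> U" using U by blast
    then show "\<exists>V. openin T V \<and> x \<in> V \<and> V \<subseteq> U"
      using cyl[of n "x n"] \<open>x \<in> U\<close> U by blast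
  qed
qed

text \<open>The odometer is closed in a product of finite discrete spaces, which is compact by
  Tychonoff.\<close>

lemma compact_T: "compact_space T"
proof -
  let ?P = "product_topology (\<lambda>n. discrete_topology (carrier (G Mod \<Gamma> n))) UNIV"
  have fin: "finite (carrier (G Mod \<Gamma> n))" for n
    using finite_index_scale[of n] by (simp add: finite_index_subgroup_def FactGroup_def)
  then have "compact_space ?P"
    by (simp add: compact_space_product_topology compact_space_discrete_topology)
  moreover have "closedin ?P (carrier X)"
  proof -
    \<comment> \<open>\<open>R n\<close> is the graph of the projection from level
      \<open>Suc n\<close> to level \<open>n\<close>. It is closed because a product of two discrete
      spaces is discrete, so the points compatible at \<open>n\<close> form a closed set.\<close>
    define R where "R n = {(a, b). \<exists>g\<in>carrier G. a = \<Gamma> (Suc n) #> g \<and> b = \<Gamma> n #> g}" for n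
    have "closedin ?P {x \<in> topspace ?P. (x (Suc n), x n) \<in> R n}" for n
    proof (rule closedin_continuous_map_preimage)
      show "continuous_map ?P (prod_topology (discrete_topology (carrier (G Mod \<Gamma> (Suc n))))
          (discrete_topology (carrier (G Mod \<Gamma> n)))) (\<lambda>x. (x (Suc n), x n))"
        by (intro continuous_map_pairedI continuous_map_product_projection) auto
      show "closedin (prod_topology (discrete_topology (carrier (G Mod \<Gamma> (Suc n))))
          (discrete_topology (carrier (G Mod \<Gamma> n)))) (R n)"
        by (auto simp: R_def carrier_FactGroup simp flip: prod_topology_discrete_topology)
    qed
    then have "closedin ?P (\<Inter>n. {x \<in> topspace ?P. (x (Suc n), x n) \<in> R n})"
      by blast
    moreover have "(\<Inter>n. {x \<in> topspace ?P. (x (Suc n), x n) \<in> R n}) = carrier X"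
      by (auto simp: carrier_X R_def PiE_iff)
    ultimately show ?thesis by simp
  qed
  ultimately show ?thesis
    unfolding odometer_topology_def
    by (intro compact_space_subtopology closedin_compact_space)
qed

text \<open>Distinct points differ at some level and, by \<open>agree_mono\<close>, at every later
  one. For a map with finite range this lets local constancy of one coordinate give local constancy
  of the map.\<close>

lemma separating_level:
  assumes "finite V" "V \<subseteq> carrier X"
  obtains N where "inj_on (\<lambda>x. x N) V"
proof -
  have "\<exists>n. v \<noteq> w \<longrightarrow> v n \<noteq> w n" for v w :: "nat \<Rightarrow> 'a set"
    by auto
  then obtain d where d: "\<And>v w :: nat \<Rightarrow> 'a set. v \<noteq> w \<Longrightarrow> v (d v w) \<noteq> w (d v w)"
    by metis
  \<comment> \<open>The values of \<open>d\<close> on the diagonal are arbitrary; they can only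
    enlarge \<open>N\<close>.\<close>
  define N where "N = Max (case_prod d ` (V \<times> V))"
  have "inj_on (\<lambda>x. x N) V"
  proof (rule inj_onI, rule ccontr)
    fix v w assume vw: "v \<in> V" "w \<in> V" "v N = w N" "v \<noteq> w"
    have "d v w \<le> N"
      unfolding N_def using assms(1) vw by (intro Max_ge) auto
    then have "v (d v w) = w (d v w)"
      using agree_mono[of v w N] vw assms(2) by auto
    then show False using d vw(4) by blast
  qed
  then show thesis by (rule that)
qed

section \<open>From commuting with a finite-index subgroup to piecewise right multiplication\<close>

lemma Homeo_closed: "f \<in> Homeo T \<Longrightarrow> x \<in> carrier X \<Longrightarrow> f x \<in> carrier X"
  unfolding Homeo_def using homeomorphic_imp_surjective_map topspace_T by blast

text \<open>This is continuity of one coordinate of \<open>f\<close>. The demand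
  \<open>m \<ge> n\<close> ensures that points of the cylinder also agree with \<open>x\<close>
  itself at level \<open>n\<close>, as the quotient below requires.\<close>

lemma Homeo_locally_constant:
  assumes f: "f \<in> Homeo T" and x: "x \<in> carrier X"
  shows "\<exists>m\<ge>n. \<forall>y\<in>carrier X. y m = x m \<longrightarrow> f y n = f x n"
proof -
  have "openin T {z \<in> carrier X. z n = f x n}"
    unfolding openin_T by (auto intro: exI[of _ n])
  moreover have "continuous_map T T f"
    using f homeomorphic_imp_continuous_map by (auto simp: Homeo_def)
  ultimately have "openin T {y \<in> topspace T. f y \<in> {z \<in> carrier X. z n = f x n}}"
    by (rule openin_continuous_map_preimage[rotated])
  moreover have "x \<in> {y \<in> topspace T. f y \<in> {z \<in> carrier X. z n = f x n}}"
    using x Homeo_closed[OF f x] by (simp add: topspace_T)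
  ultimately have "\<exists>k. \<forall>y\<in>carrier X. y k = x k \<longrightarrow>
      y \<in> {y \<in> topspace T. f y \<in> {z \<in> carrier X. z n = f x n}}"
    unfolding openin_T by (meson bspec)
  then obtain k where "\<forall>y\<in>carrier X. y k = x k \<longrightarrow>
      y \<in> {y \<in> topspace T. f y \<in> {z \<in> carrier X. z n = f x n}}" ..
  then have k: "f y n = f x n" if "y \<in> carrier X" "y k = x k" for y
    using that by simp
  have "f y n = f x n" if "y \<in> carrier X" "y (max n k) = x (max n k)" for y
    using that(1) agree_mono[OF that(1) x that(2) max.cobounded2] by (rule k)
  then show ?thesis
    by (intro exI[of _ "max n k"]) simp
qed

text \<open>Operations in the odometer are coordinatewise, so level \<open>n\<close> of the quotient
  depends only on level \<open>n\<close> of \<open>x\<close> and of \<open>f x\<close>.\<close>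

lemma quotient_locally_constant:
  assumes f: "f \<in> Homeo T" and x: "x \<in> carrier X"
  shows "\<exists>m. \<forall>y\<in>carrier X. y m = x m \<longrightarrow>
    (inv\<^bsub>X\<^esub> y \<otimes>\<^bsub>X\<^esub> f y) n = (inv\<^bsub>X\<^esub> x \<otimes>\<^bsub>X\<^esub> f x) n"
proof -
  obtain m where m: "n \<le> m" "\<And>y. \<lbrakk>y \<in> carrier X; y m = x m\<rbrakk> \<Longrightarrow> f y n = f x n"
    using Homeo_locally_constant[OF f x, of n] by blast
  have "(inv\<^bsub>X\<^esub> y \<otimes>\<^bsub>X\<^esub> f y) n = (inv\<^bsub>X\<^esub> x \<otimes>\<^bsub>X\<^esub> f x) n"
    if y: "y \<in> carrier X" "y m = x m" for y
    using m(2)[OF y] agree_mono[OF y(1) x y(2) m(1)] by (simp add: mult_X inv_X x y(1))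
  then show ?thesis by blast
qed

lemma quotient_finite_range:
  assumes H: "finite_index_subgroup H G"
    and f: "f \<in> action_Aut T (odometer_action G \<Gamma>) (G\<lparr>carrier := H\<rparr>)"
  shows "finite ((\<lambda>x. inv\<^bsub>X\<^esub> x \<otimes>\<^bsub>X\<^esub> f x) ` carrier X)"
proof -
  define c where "c x = inv\<^bsub>X\<^esub> x \<otimes>\<^bsub>X\<^esub> f x" for x
  have fH: "f \<in> Homeo T" using f by (simp add: action_Aut_def)
  have sH: "subgroup H G" and fin: "finite (rcosets H)"
    using H by (auto simp: finite_index_subgroup_def)
  have c_closed: "c x \<in> carrier X" if "x \<in> carrier X" for x
    using that Homeo_closed[OF fH] by (simp add: c_def)
  have c_invariant: "c (\<tau> (h \<otimes> g)) = c (\<tau> g)" if h: "h \<in> H" and g: "g \<in> carrier G" for g h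
  proof -
    have hG: "h \<in> carrier G" using subgroup.mem_carrier[OF sH h] .
    note car = embedding_in_X[OF hG] embedding_in_X[OF g] Homeo_closed[OF fH embedding_in_X[OF g]]
    have "f (\<tau> h \<otimes>\<^bsub>X\<^esub> \<tau> g) = \<tau> h \<otimes>\<^bsub>X\<^esub> f (\<tau> g)"
      using f h car by (simp add: action_Aut_def topspace_T odometer_action_def)
    then have "c (\<tau> (h \<otimes> g)) = inv\<^bsub>X\<^esub> (\<tau> h \<otimes>\<^bsub>X\<^esub> \<tau> g) \<otimes>\<^bsub>X\<^esub> (\<tau> h \<otimes>\<^bsub>X\<^esub> f (\<tau> g))"
      by (simp add: c_def embedding_mult hG g)
    also have "\<dots> = inv\<^bsub>X\<^esub> \<tau> g \<otimes>\<^bsub>X\<^esub> (inv\<^bsub>X\<^esub> \<tau> h \<otimes>\<^bsub>X\<^esub> (\<tau> h \<otimes>\<^bsub>X\<^esub> f (\<tau> g)))"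
      using car by (simp add: X.inv_mult_group X.m_assoc)
    also have "\<dots> = c (\<tau> g)"
      using car by (simp add: c_def X.m_assoc[symmetric])
    finally show ?thesis .
  qed
  define V where "V = c ` \<tau> ` carrier G"
  \<comment> \<open>By invariance \<open>c\<close> can be read off at any representative of a right
    coset of \<open>H\<close>, so the finitely many cosets index all of \<open>V\<close>.\<close>
  have "V \<subseteq> (\<lambda>C. c (\<tau> (SOME g. g \<in> C))) ` (rcosets H)"
  proof
    fix v assume "v \<in> V"
    then obtain g where g: "g \<in> carrier G" "v = c (\<tau> g)" by (auto simp: V_def)
    have "(SOME g'. g' \<in> H #> g) \<in> H #> g"
      using rcos_self[OF g(1) sH] by (rule someI)
    then obtain h where "h \<in> H" "(SOME g'. g' \<in> H #> g) = h \<otimes> g"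
      by (auto simp: r_coset_def)
    then have "v = c (\<tau> (SOME g'. g' \<in> H #> g))"
      using c_invariant g by simp
    then show "v \<in> (\<lambda>C. c (\<tau> (SOME g. g \<in> C))) ` (rcosets H)"
      using g(1) by (auto simp: RCOSETS_def)
  qed
  then have finV: "finite V" using fin finite_surj by blast
  have VX: "V \<subseteq> carrier X" using c_closed embedding_in_X by (auto simp: V_def)
  have "c x \<in> V" if x: "x \<in> carrier X" for x
  proof -
    \<comment> \<open>Membership of \<open>c x\<close> in \<open>V\<close> is still open, so
      \<open>c x\<close> is adjoined before a level is chosen. A point \<open>\<tau> g\<close> close
      to \<open>x\<close> then has a value in \<open>V\<close> that agrees with \<open>c x\<close>
      at \<open>N\<close>, hence equals it.\<close>
    obtain N where N: "inj_on (\<lambda>v. v N) (insert (c x) V)"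
      using separating_level[of "insert (c x) V"] finV VX c_closed[OF x] by auto
    have "\<exists>m. \<forall>y\<in>carrier X. y m = x m \<longrightarrow> c y N = c x N"
      unfolding c_def by (rule quotient_locally_constant[OF fH x])
    then obtain m where m: "\<And>y. \<lbrakk>y \<in> carrier X; y m = x m\<rbrakk> \<Longrightarrow> c y N = c x N"
      by blast
    obtain g where g: "g \<in> carrier G" "\<tau> g m = x m"
      by (rule embedding_dense[OF x])
    have "c (\<tau> g) = c x"
    proof (rule inj_onD[OF N])
      show "c (\<tau> g) N = c x N" using m embedding_in_X g by simp
    qed (use g in \<open>auto simp: V_def\<close>)
    then show ?thesis using g(1) unfolding V_def by (metis imageI)
  qed
  then have "c ` carrier X \<subseteq> V" by (rule image_subsetI)
  then show ?thesis
    using finV unfolding c_def by (rule finite_subset)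
qed

lemma stabilized_Aut_subset_full_group:
  "stabilized_Aut T (odometer_action G \<Gamma>) G \<subseteq> topological_full_group X T (right_mult_action X)"
proof
  fix f assume "f \<in> stabilized_Aut T (odometer_action G \<Gamma>) G"
  then obtain H where H: "finite_index_subgroup H G"
    and f: "f \<in> action_Aut T (odometer_action G \<Gamma>) (G\<lparr>carrier := H\<rparr>)"
    by (auto simp: stabilized_Aut_def)
  have fH: "f \<in> Homeo T" using f by (simp add: action_Aut_def)
  define c where "c x = inv\<^bsub>X\<^esub> x \<otimes>\<^bsub>X\<^esub> f x" for x
  have c_closed: "c x \<in> carrier X" if "x \<in> carrier X" for x
    using that Homeo_closed[OF fH] by (simp add: c_def)
  have fin: "finite (c ` carrier X)"
    using quotient_finite_range[OF H f] by (simp add: c_def)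
  obtain N where N: "inj_on (\<lambda>v. v N) (c ` carrier X)"
    using separating_level[OF fin] c_closed by blast
  \<comment> \<open>Allowing an arbitrary set \<open>V\<close> covers a fibre and its complement at
    once, so the fibres are clopen.\<close>
  have open_fibre: "openin T {x \<in> carrier X. c x \<in> V}" for V
    unfolding openin_T
  proof (intro conjI ballI)
    fix x assume "x \<in> {x \<in> carrier X. c x \<in> V}"
    then have x: "x \<in> carrier X" "c x \<in> V" by auto
    have "\<exists>m. \<forall>y\<in>carrier X. y m = x m \<longrightarrow> c y N = c x N"
      unfolding c_def by (rule quotient_locally_constant[OF fH x(1)])
    then obtain m where m: "\<And>y. \<lbrakk>y \<in> carrier X; y m = x m\<rbrakk> \<Longrightarrow> c y N = c x N"
      by blast
    have "c y = c x" if "y \<in> carrier X" "y m = x m" for y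
    proof (rule inj_onD[OF N])
      show "c y N = c x N" using that by (rule m)
    qed (use that(1) x(1) in auto)
    then show "\<exists>n. \<forall>y\<in>carrier X. y n = x n \<longrightarrow> y \<in> {x \<in> carrier X. c x \<in> V}"
      using x(2) by (intro exI[of _ m]) simp
  qed auto
  define F where "F v = {x \<in> carrier X. c x = v}" for v
  have F_open: "openin T (F v)" for v
    using open_fibre[of "{v}"] by (simp add: F_def)
  have F_closed: "closedin T (F v)" for v
  proof -
    have "carrier X - F v = {x \<in> carrier X. c x \<in> - {v}}" by (auto simp: F_def)
    then show ?thesis
      using open_fibre[of "- {v}"] by (auto simp: closedin_def topspace_T F_def)
  qed
  have partition: "partition_on (topspace T) (F ` c ` carrier X)"
    by (rule partition_onI) (auto simp: F_def topspace_T disjnt_def)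
  \<comment> \<open>The full group asks for a group element depending on the piece as a set, so the
    value is recovered at a chosen point of the piece. The inverse cancels the one in
    \<open>right_mult_action\<close>, leaving \<open>y\<close> times \<open>c y\<close>, which is
    \<open>f y\<close>.\<close>
  have f_eq: "f y = right_mult_action X (inv\<^bsub>X\<^esub> c (SOME x. x \<in> F v)) y"
    if "y \<in> F v" for v y
  proof -
    have "(SOME x. x \<in> F v) \<in> F v" using someI[of "\<lambda>x. x \<in> F v", OF that] .
    then have "c (SOME x. x \<in> F v) = c y" using that by (simp add: F_def)
    moreover have y: "y \<in> carrier X" using that by (simp add: F_def)
    moreover have "y \<otimes>\<^bsub>X\<^esub> c y = f y"
      using y Homeo_closed[OF fH y] by (simp add: c_def X.m_assoc[symmetric])
    ultimately show ?thesis
      using c_closed by (simp add: right_mult_action_def)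
  qed
  have F_const: "inv\<^bsub>X\<^esub> c (SOME x. x \<in> F v) \<in> carrier X" if "v \<in> c ` carrier X" for v
  proof -
    have "\<exists>x. x \<in> F v" using that by (auto simp: F_def)
    then have "(SOME x. x \<in> F v) \<in> F v" by (rule someI_ex)
    then have "(SOME x. x \<in> F v) \<in> carrier X" by (simp add: F_def)
    then show ?thesis using c_closed by blast
  qed
  have pieces: "\<forall>A\<in>F ` c ` carrier X. openin T A \<and> closedin T A \<and>
      inv\<^bsub>X\<^esub> c (SOME x. x \<in> A) \<in> carrier X \<and>
      (\<forall>y\<in>A. f y = right_mult_action X (inv\<^bsub>X\<^esub> c (SOME x. x \<in> A)) y)"
  proof (intro ballI conjI)
    fix A y assume "A \<in> F ` c ` carrier X"
    then obtain v where v: "v \<in> c ` carrier X" "A = F v" by (rule imageE)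
    show "openin T A" "closedin T A" "inv\<^bsub>X\<^esub> c (SOME x. x \<in> A) \<in> carrier X"
      unfolding v(2) by (rule F_open F_closed F_const[OF v(1)])+
    show "f y = right_mult_action X (inv\<^bsub>X\<^esub> c (SOME x. x \<in> A)) y" if "y \<in> A"
      using that unfolding v(2) by (rule f_eq)
  qed
  have "\<exists>P \<xi>. finite P \<and> partition_on (topspace T) P \<and>
      (\<forall>A\<in>P. openin T A \<and> closedin T A \<and> \<xi> A \<in> carrier X \<and>
        (\<forall>y\<in>A. f y = right_mult_action X (\<xi> A) y))"
    by (rule exI, rule exI, rule conjI[OF finite_imageI[OF fin] conjI[OF partition pieces]])
  then show "f \<in> topological_full_group X T (right_mult_action X)"
    using fH by (simp only: topological_full_group_def mem_Collect_eq)
qed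

section \<open>From the full group back to commutation, and the equality\<close>

lemma full_group_commutes:
  assumes "f \<in> topological_full_group X T (right_mult_action X)"
  obtains n where "f \<in> action_Aut T (odometer_action G \<Gamma>) (G\<lparr>carrier := \<Gamma> n\<rparr>)"
proof -
  have fH: "f \<in> Homeo T" using assms by (simp add: topological_full_group_def)
  obtain P \<xi> where P: "partition_on (topspace T) P"
    and P_all: "\<forall>A\<in>P. openin T A \<and> closedin T A \<and> \<xi> A \<in> carrier X \<and>
      (\<forall>y\<in>A. f y = right_mult_action X (\<xi> A) y)"
    using assms unfolding topological_full_group_def by blast
  have P_open: "openin T A" and \<xi>: "\<xi> A \<in> carrier X" if "A \<in> P" for A
    using bspec[OF P_all that] by simp_all
  have f_eq: "f y = right_mult_action X (\<xi> A) y" if "A \<in> P" "y \<in> A" for A y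
    using bspec[OF P_all that(1)] that(2) by simp
  have P_cover: "\<Union>P = carrier X"
    using partition_onD1[OF P] by (simp add: topspace_T)
  define C where "C n x = {y \<in> carrier X. y n = x n}" for n and x :: "nat \<Rightarrow> 'a set"
  have "\<exists>n. \<exists>A\<in>P. C n x \<subseteq> A" if "x \<in> carrier X" for x
  proof -
    have "x \<in> \<Union>P" using that P_cover by simp
    then obtain A where A: "A \<in> P" "x \<in> A" by (rule UnionE)
    then obtain n where "\<forall>y\<in>carrier X. y n = x n \<longrightarrow> y \<in> A"
      using P_open[OF A(1)] unfolding openin_T by (meson bspec)
    then have "C n x \<subseteq> A" unfolding C_def by auto
    then show ?thesis using A(1) by (intro exI bexI)
  qed
  \<comment> \<open>\<open>l x\<close> is a level at which the cylinder around \<open>x\<close> fits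
    into one piece; compactness leaves finitely many such levels.\<close>
  then obtain l where l: "\<And>x. x \<in> carrier X \<Longrightarrow> \<exists>A\<in>P. C (l x) x \<subseteq> A" by metis
  have C_open: "openin T (C n x)" for n x
    unfolding openin_T C_def by (auto intro: exI[of _ n])
  have C_cover: "topspace T \<subseteq> \<Union>((\<lambda>x. C (l x) x) ` carrier X)"
    by (auto simp: C_def topspace_T)
  obtain \<F> where \<F>: "finite \<F>" "\<F> \<subseteq> (\<lambda>x. C (l x) x) ` carrier X" "carrier X \<subseteq> \<Union>\<F>"
    using compactinD[OF compact_T[unfolded compact_space_def] _ C_cover] C_open
    unfolding topspace_T by blast
  then obtain S where S: "S \<subseteq> carrier X" "finite S" "\<F> = (\<lambda>x. C (l x) x) ` S"
    by (meson finite_subset_image)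
  define n where "n = Max (l ` S)"
  have n: "l s \<le> n" if "s \<in> S" for s
    unfolding n_def using that S(2) by simp
  have "f (odometer_action G \<Gamma> h x) = odometer_action G \<Gamma> h (f x)"
    if h: "h \<in> \<Gamma> n" and x: "x \<in> carrier X" for h x
  proof -
    obtain s where s: "s \<in> S" "x \<in> C (l s) s" using \<F>(3) S(3) x by auto
    obtain A where A: "A \<in> P" "C (l s) s \<subseteq> A" using l s(1) S(1) by blast
    have hX: "\<tau> h \<in> carrier X"
      using embedding_in_X subgroup.mem_carrier[OF subgroup_scale h] by blast
    \<comment> \<open>As \<open>n\<close> is at least \<open>l s\<close>, translation by
      \<open>\<tau> h\<close> keeps \<open>x\<close> in the cylinder around \<open>s\<close>, hence
      in the piece \<open>A\<close>. The same \<open>\<xi> A\<close> then acts at both points, and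
      associativity gives commutation.\<close>
    have "h \<in> \<Gamma> (l s)" using scale_mono[OF n[OF s(1)]] h by blast
    then have "\<tau> h \<otimes>\<^bsub>X\<^esub> x \<in> C (l s) s"
      using embedding_mult_scale[of h "l s" x] s(2) hX x by (simp add: C_def)
    then have "\<tau> h \<otimes>\<^bsub>X\<^esub> x \<in> A" "x \<in> A" using A(2) s(2) by auto
    then have "f (\<tau> h \<otimes>\<^bsub>X\<^esub> x) = \<tau> h \<otimes>\<^bsub>X\<^esub> f x"
      using hX x \<xi>[OF A(1)] by (simp add: f_eq[OF A(1)] right_mult_action_def X.m_assoc)
    then show ?thesis
      using x Homeo_closed[OF fH x] by (simp add: odometer_action_def)
  qed
  then have "f \<in> action_Aut T (odometer_action G \<Gamma>) (G\<lparr>carrier := \<Gamma> n\<rparr>)"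
    using fH by (simp add: action_Aut_def topspace_T)
  then show thesis by (rule that)
qed

lemma action_Aut_subset_stabilized_Aut:
  "action_Aut T (odometer_action G \<Gamma>) (G\<lparr>carrier := \<Gamma> n\<rparr>) \<subseteq> stabilized_Aut T (odometer_action G \<Gamma>) G"
  unfolding stabilized_Aut_def by (rule UN_upper) (simp add: finite_index_scale)

lemma stabilized_Aut_eq_full_group:
  "stabilized_Aut T (odometer_action G \<Gamma>) G = topological_full_group X T (right_mult_action X)"
proof
  show "topological_full_group X T (right_mult_action X) \<subseteq> stabilized_Aut T (odometer_action G \<Gamma>) G"
  proof
    fix f assume "f \<in> topological_full_group X T (right_mult_action X)"
    then obtain n where "f \<in> action_Aut T (odometer_action G \<Gamma>) (G\<lparr>carrier := \<Gamma> n\<rparr>)"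
      by (rule full_group_commutes)
    then show "f \<in> stabilized_Aut T (odometer_action G \<Gamma>) G"
      using action_Aut_subset_stabilized_Aut by (rule rev_subsetD)
  qed
qed (rule stabilized_Aut_subset_full_group)

text \<open>The passage through the full group replaces an arbitrary finite-index subgroup by a
  member of the scale, turning the union into one over a chain.\<close>

lemma stabilized_Aut_eq_Union:
  "stabilized_Aut T (odometer_action G \<Gamma>) G =
    (\<Union>n. action_Aut T (odometer_action G \<Gamma>) (G\<lparr>carrier := \<Gamma> n\<rparr>))"
proof
  show "stabilized_Aut T (odometer_action G \<Gamma>) G \<subseteq>
      (\<Union>n. action_Aut T (odometer_action G \<Gamma>) (G\<lparr>carrier := \<Gamma> n\<rparr>))"
  proof
    fix f assume "f \<in> stabilized_Aut T (odometer_action G \<Gamma>) G"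
    then obtain n where "f \<in> action_Aut T (odometer_action G \<Gamma>) (G\<lparr>carrier := \<Gamma> n\<rparr>)"
      unfolding stabilized_Aut_eq_full_group by (rule full_group_commutes)
    then show "f \<in> (\<Union>n. action_Aut T (odometer_action G \<Gamma>) (G\<lparr>carrier := \<Gamma> n\<rparr>))"
      by (rule UN_I[OF UNIV_I])
  qed
qed (intro UN_least action_Aut_subset_stabilized_Aut)

lemma subgroup_stabilized_Aut:
  "subgroup (stabilized_Aut T (odometer_action G \<Gamma>) G) (HomeoGroup T)"
  unfolding stabilized_Aut_eq_Union
proof (rule subgroup_incseq_UN[OF group_HomeoGroup])
  show "subgroup (action_Aut T (odometer_action G \<Gamma>) (G\<lparr>carrier := \<Gamma> n\<rparr>)) (HomeoGroup T)" for n
    using embedding_in_X subgroup.mem_carrier[OF subgroup_scale]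
    by (intro subgroup_action_Aut) (auto simp: odometer_action_def topspace_T)
  \<comment> \<open>The scale decreases, so later levels impose fewer commutation
    conditions.\<close>
  show "incseq (\<lambda>n. action_Aut T (odometer_action G \<Gamma>) (G\<lparr>carrier := \<Gamma> n\<rparr>))"
    using scale_mono by (fastforce simp: incseq_def action_Aut_def)
qed

end

theorem theorem1p2:
  fixes G :: "('a, 'b) monoid_scheme" and \<Gamma> :: "nat \<Rightarrow> 'a set"
    and X :: "(nat \<Rightarrow> 'a set) monoid" and T :: "(nat \<Rightarrow> 'a set) topology"
  assumes "group G" and "countable (carrier G)" and "infinite (carrier G)"
    and "residually_finite G"
    and "group_scale G \<Gamma>"
    and "X = odometer G \<Gamma>" and "T = odometer_topology G \<Gamma>"
  shows "subgroup (stabilized_Aut T (odometer_action G \<Gamma>) G) (HomeoGroup T) \<and>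
    subgroup (topological_full_group X T (right_mult_action X)) (HomeoGroup T) \<and>
    stabilized_Aut T (odometer_action G \<Gamma>) G = topological_full_group X T (right_mult_action X)"
proof -
  interpret scaled_group G \<Gamma>
    using assms(1,5) by (intro scaled_group.intro scaled_group_axioms.intro)
  show ?thesis
    \<comment> \<open>Rewriting the full group as the stabilized group makes both subgroup claims
      the same.\<close>
    unfolding assms(6,7) stabilized_Aut_eq_full_group[symmetric]
    using subgroup_stabilized_Aut by simp
qed

end
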